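(* Under bilateral link formation, the simple-minded adversary induces convex cost: for every $n\ge3$, every strategy profile $S$ for $n$ players with connected final graph $G(S)$, every player $v$ and all distinct players $w_1,\dots,w_k\ne v$ ($k\ge 1$), $$I_v\big(S-(v,w_1)-\dots-(v,w_k)\big)-I_v(S)\;\ge\;\sum_{i=1}^k\Big(I_v\big(S-(v,w_i)\big)-I_v(S)\Big),$$ where $I_v$ is the disconnection cost for the simple-minded adversary.
   Context: Players are $V=\{1,\dots,n\}$ ($n\ge 3$). A strategy profile is a matrix $S\in\{0,1\}^{n\times n}$ with $S_{vv}=0$; for $v\ne w$, $S_{vw}=1$ means that player $v$ requests the edge $\{v,w\}$. Bilateral link formation: the final graph is the simple undirected graph $G(S)=(V,E(S))$ with $E(S)=\{\{v,w\}: S_{vw}=1 \text{ and } S_{wv}=1\}$. $S-(v,w)$ denotes $S$ with the entry $S_{vw}$ set to $0$. For a connected graph $G=(V,E)$, $e\in E$, $v\in V$, the relevance $\mathrm{rel}_G(e,v)$ is the number of vertices that, starting at $v$, can only be reached via $e$ (so it is $0$ iff $e$ is not a bridge). The simple-minded adversary removes one edge chosen uniformly at random; so the disconnection cost of $v$ is $I_v(S)=I_v(G(S))$, where $I_v(G)=\frac{1}{|E|}\sum_{e\in E}\mathrm{rel}_G(e,v)$ if $G$ is connected and $I_v(G)=\infty$ otherwise (values in $[0,\infty]$ with the usual conventions). Individual cost with link cost $\alpha>0$ is $C_v(S)=\alpha\sum_w S_{vw}+I_v(S)$; the inequality in the claim is equivalent to the corresponding convexity inequality with $C_v$ in place of $I_v$.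 *)

theory Defs
  imports "HOL-Library.Extended_Real"
begin

text \<open>Simple undirected graphs are pairs of a vertex set and a set of two-element vertex sets.\<close>

type_synonym 'a graph = "'a set \<times> 'a set set"

definition walk_edges :: "'a list \<Rightarrow> 'a set list" where
  "walk_edges p = map (\<lambda>(x, y). {x, y}) (zip p (tl p))"

definition walk_betw :: "'a graph \<Rightarrow> 'a \<Rightarrow> 'a list \<Rightarrow> 'a \<Rightarrow> bool" where
  "walk_betw G u p w \<longleftrightarrow>
     p \<noteq> [] \<and> hd p = u \<and> last p = w \<and> set p \<subseteq> fst G \<and> set (walk_edges p) \<subseteq> snd G"

definition connected_graph :: "'a graph \<Rightarrow> bool" where
  "connected_graph G \<longleftrightarrow> (\<forall>u\<in>fst G. \<forall>w\<in>fst G. \<exists>p. walk_betw G u p w)"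

text \<open>The number of vertices that, starting at \<open>v\<close>, can only be reached via \<open>e\<close>. This is meant
  for connected \<open>G\<close>: a vertex not reachable from \<open>v\<close> at all would be counted vacuously.\<close>

definition relevance :: "'a graph \<Rightarrow> 'a set \<Rightarrow> 'a \<Rightarrow> nat" where
  "relevance G e v =
     card {u \<in> fst G. \<forall>p. walk_betw G v p u \<longrightarrow> e \<in> set (walk_edges p)}"

text \<open>The expected relevance of an edge drawn uniformly at random (the simple-minded adversary).\<close>

definition graph_disconnection_cost :: "'a graph \<Rightarrow> 'a \<Rightarrow> ereal" where
  "graph_disconnection_cost G v =
     (if connected_graph G
      then ereal (1 / real (card (snd G)) * (\<Sum>e\<in>snd G. real (relevance G e v)))
      else \<infinity>)"

definition players :: "nat \<Rightarrow> nat set" where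
  "players n = {1..n}"

text \<open>An \<open>n \<times> n\<close> matrix is a function of two indices; entries with an index outside
  \<open>players n\<close> are irrelevant and left unconstrained.\<close>

type_synonym profile = "nat \<Rightarrow> nat \<Rightarrow> nat"

definition strategy_profile :: "nat \<Rightarrow> profile \<Rightarrow> bool" where
  "strategy_profile n S \<longleftrightarrow>
     (\<forall>v\<in>players n. \<forall>w\<in>players n. S v w \<in> {0, 1}) \<and> (\<forall>v\<in>players n. S v v = 0)"

definition remove_request :: "profile \<Rightarrow> nat \<times> nat \<Rightarrow> profile" where
  "remove_request S = (\<lambda>(v, w). S(v := (S v)(w := 0)))"

text \<open>Bilateral link formation: an edge is built iff both endpoints request it.\<close>

definition bilateral_graph :: "nat \<Rightarrow> profile \<Rightarrow> nat graph" where
  "bilateral_graph n S =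
     (players n, {{v, w} | v w. v \<in> players n \<and> w \<in> players n \<and> S v w = 1 \<and> S w v = 1})"

definition disconnection_cost :: "nat \<Rightarrow> profile \<Rightarrow> nat \<Rightarrow> ereal" where
  "disconnection_cost n S v = graph_disconnection_cost (bilateral_graph n S) v"

end

theory Submission imports Defs
begin

text \<open>The relevances of all edges for \<open>v\<close> add up to the number of pairs \<open>(e, u)\<close> such that \<open>e\<close>
  separates \<open>v\<close> from \<open>u\<close>. Deleting edges only adds such pairs. If \<open>{e\<^sub>i, f}\<close> and \<open>{e\<^sub>j, f}\<close> both
  separate \<open>v\<close> from \<open>u\<close>, where \<open>e\<^sub>i \<noteq> e\<^sub>j\<close> are incident to \<open>v\<close>, then so does \<open>f\<close> alone, since a
  simple path starting at \<open>v\<close> uses at most one edge incident to \<open>v\<close>. Hence the pairs that become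
  separating by the deletion of \<open>e\<^sub>1\<close>, \<dots>, \<open>e\<^sub>k\<close> one at a time are disjoint, and all of them become
  separating when these edges are deleted together. With \<open>m\<close> edges, \<open>b\<close> pairs initially and
  \<open>D\<close> new ones, it remains to compare \<open>(b + D) / (m - k) - b / m\<close> with
  \<open>D / (m - 1) + k * b / (m * (m - 1))\<close>.\<close>

section \<open>Walks and their edges\<close>

lemma walk_edges_simps [simp]:
  "walk_edges [] = []"
  "walk_edges [x] = []"
  "walk_edges (x # y # zs) = {x, y} # walk_edges (y # zs)"
  by (simp_all add: walk_edges_def)

lemma walk_edges_append_subset: "set (walk_edges ys) \<subseteq> set (walk_edges (xs @ ys))"
proof (induction xs)
  case (Cons x xs)
  then show ?case
    by (cases "xs @ ys") auto
qed simp

lemma walk_edges_subset_vertices: "e \<in> set (walk_edges p) \<Longrightarrow> e \<subseteq> set p"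
proof (induction p)
  case (Cons x p)
  then show ?case
    by (cases p) auto
qed simp

lemma walk_betw_mono: "walk_betw (V, E) v p u \<Longrightarrow> E \<subseteq> E' \<Longrightarrow> walk_betw (V, E') v p u"
  by (auto simp: walk_betw_def)

lemma connected_graph_mono: "connected_graph (V, E) \<Longrightarrow> E \<subseteq> E' \<Longrightarrow> connected_graph (V, E')"
  unfolding connected_graph_def by (metis fst_conv walk_betw_mono)

lemma walk_leaving_start_once:
  assumes "walk_betw G v p u"
  obtains ys where "walk_betw G v (v # ys) u" "v \<notin> set ys"
    "set (walk_edges (v # ys)) \<subseteq> set (walk_edges p)"
proof -
  have "v \<in> set p"
    using assms by (auto simp: walk_betw_def)
  then obtain xs ys where p: "p = xs @ v # ys" "v \<notin> set ys"
    by (meson split_list_last)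
  have sub: "set (walk_edges (v # ys)) \<subseteq> set (walk_edges p)"
    unfolding p by (rule walk_edges_append_subset)
  then have "walk_betw G v (v # ys) u"
    using assms p by (auto simp: walk_betw_def)
  then show thesis
    using that p sub by blast
qed

section \<open>Separating pairs\<close>

text \<open>\<open>e\<close> ranges over all sets, so an unreachable \<open>u\<close> is paired with
  every \<open>e\<close>. This keeps antimonotonicity unconditional; connectedness confines the
  pairs to \<open>E \<times> V\<close>.\<close>

definition separating_pairs :: "'a set \<Rightarrow> 'a \<Rightarrow> 'a set set \<Rightarrow> ('a set \<times> 'a) set" where
  "separating_pairs V v E =
     {(e, u). u \<in> V \<and> (\<forall>p. walk_betw (V, E) v p u \<longrightarrow> e \<in> set (walk_edges p))}"

lemma separating_pairs_antimono:
  "E \<subseteq> E' \<Longrightarrow> separating_pairs V v E' \<subseteq> separating_pairs V v E"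
  using walk_betw_mono[of V E v _ _ E'] by (auto simp: separating_pairs_def)

lemma separating_pairs_subset:
  assumes "connected_graph (V, E)" "v \<in> V"
  shows "separating_pairs V v E \<subseteq> E \<times> V"
proof (rule subrelI)
  fix e u
  assume eu: "(e, u) \<in> separating_pairs V v E"
  then have "u \<in> V"
    by (simp add: separating_pairs_def)
  with assms obtain p where "walk_betw (V, E) v p u"
    by (auto simp: connected_graph_def)
  then show "(e, u) \<in> E \<times> V"
    using eu by (auto simp: separating_pairs_def walk_betw_def)
qed

lemma separating_pairs_Int:
  assumes "w \<noteq> w'" "w \<noteq> v" "w' \<noteq> v"
  shows "separating_pairs V v (E - {{v, w}}) \<inter> separating_pairs V v (E - {{v, w'}})
           \<subseteq> separating_pairs V v E"
proof (rule subrelI)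
  fix f u
  assume fu: "(f, u) \<in> separating_pairs V v (E - {{v, w}}) \<inter> separating_pairs V v (E - {{v, w'}})"
  have "f \<in> set (walk_edges p)" if p: "walk_betw (V, E) v p u" for p
  proof -
    obtain ys where ys: "walk_betw (V, E) v (v # ys) u" "v \<notin> set ys"
      "set (walk_edges (v # ys)) \<subseteq> set (walk_edges p)"
      using walk_leaving_start_once[OF p] .
    have "{v, w} \<notin> set (walk_edges (v # ys)) \<or> {v, w'} \<notin> set (walk_edges (v # ys))"
      \<comment> \<open>Only the first edge of \<open>v # ys\<close> can contain \<open>v\<close>,
        and it cannot equal both deleted edges.\<close>
      using ys(2) assms by (cases ys) (auto simp: doubleton_eq_iff dest: walk_edges_subset_vertices)
    then have "walk_betw (V, E - {{v, w}}) v (v # ys) u \<or> walk_betw (V, E - {{v, w'}}) v (v # ys) u"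
      using ys(1) by (auto simp: walk_betw_def)
    then show ?thesis
      using fu ys(3) by (auto simp: separating_pairs_def)
  qed
  then show "(f, u) \<in> separating_pairs V v E"
    using fu by (auto simp: separating_pairs_def)
qed

text \<open>Double counting: \<open>relevance (V, E) e v\<close> is the size of the fibre of the
  pairs over \<open>e\<close>.\<close>

lemma sum_relevance_eq_card:
  assumes "connected_graph (V, E)" "v \<in> V" "finite V" "finite E"
  shows "(\<Sum>e\<in>E. relevance (V, E) e v) = card (separating_pairs V v E)"
proof -
  have "separating_pairs V v E =
      (SIGMA e:E. {u \<in> V. \<forall>p. walk_betw (V, E) v p u \<longrightarrow> e \<in> set (walk_edges p)})"
    using separating_pairs_subset[OF assms(1,2)] by (auto simp: separating_pairs_def)
  then show ?thesis
    using assms by (simp add: relevance_def)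
qed

lemma graph_disconnection_cost_connected:
  assumes "connected_graph (V, E)" "v \<in> V" "finite V" "finite E"
  shows "graph_disconnection_cost (V, E) v =
    ereal (real (card (separating_pairs V v E)) / real (card E))"
proof -
  have "(\<Sum>e\<in>E. real (relevance (V, E) e v)) = real (card (separating_pairs V v E))"
    using sum_relevance_eq_card[OF assms] by (metis of_nat_sum)
  then show ?thesis
    using assms(1) by (simp add: graph_disconnection_cost_def)
qed

section \<open>Counting and averaging estimates\<close>

text \<open>The sets \<open>A i - P\<close> are pairwise disjoint and lie in
  \<open>Q - P\<close>.\<close>

lemma sum_card_increments_le:
  assumes "finite Q" "finite I" "\<And>i. i \<in> I \<Longrightarrow> P \<subseteq> A i" "\<And>i. i \<in> I \<Longrightarrow> A i \<subseteq> Q" "P \<subseteq> Q"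
    and "\<And>i j. i \<in> I \<Longrightarrow> j \<in> I \<Longrightarrow> i \<noteq> j \<Longrightarrow> A i \<inter> A j \<subseteq> P"
  shows "(\<Sum>i\<in>I. real (card (A i)) - real (card P)) \<le> real (card Q) - real (card P)"
proof -
  have fin: "finite P" "\<And>i. i \<in> I \<Longrightarrow> finite (A i)"
    using assms finite_subset by metis+
  have diff: "real (card B) - real (card P) = real (card (B - P))" if "P \<subseteq> B" "B \<subseteq> Q" for B
    using that fin assms(1) by (simp add: card_Diff_subset card_mono finite_subset of_nat_diff)
  have "(\<Sum>i\<in>I. card (A i - P)) = card (\<Union>i\<in>I. A i - P)"
    using assms fin by (intro card_UN_disjoint[symmetric]) blast+
  also have "\<dots> \<le> card (Q - P)"
    using assms by (intro card_mono) auto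
  finally have "(\<Sum>i\<in>I. real (card (A i - P))) \<le> real (card (Q - P))"
    by (metis of_nat_sum of_nat_le_iff)
  then show ?thesis
    using assms diff by simp
qed

lemma mean_increment_le:
  fixes a b k m :: real
  assumes "0 \<le> b" "0 \<le> D" "b + D \<le> a" "1 \<le> k" "k < m"
  shows "D / (m - 1) + k * b / (m * (m - 1)) \<le> a / (m - k) - b / m"
proof -
  \<comment> \<open>As \<open>1 \<le> k\<close>, shrinking the denominator to \<open>m - k\<close>
    only enlarges both terms; the result then collapses to a difference of two means.\<close>
  have "D / (m - 1) + k * b / (m * (m - 1)) \<le> D / (m - k) + k * b / (m * (m - k))"
    using assms by (intro add_mono divide_left_mono mult_left_mono mult_pos_pos) auto
  also have "\<dots> = (b + D) / (m - k) - b / m"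
    using assms by (simp add: divide_simps) (simp add: algebra_simps)
  also have "\<dots> \<le> a / (m - k) - b / m"
    using assms by (intro diff_right_mono divide_right_mono) auto
  finally show ?thesis .
qed

lemma graph_disconnection_cost_convex:
  fixes E :: "'a set set"
  assumes V: "finite V" "v \<in> V" and E: "finite E"
    and W: "finite W" "v \<notin> W" "(\<lambda>w. {v, w}) ` W \<subseteq> E"
    and ne: "E - (\<lambda>w. {v, w}) ` W \<noteq> {}"
    and con: "connected_graph (V, E)"
  shows "(\<Sum>w\<in>W. graph_disconnection_cost (V, E - {{v, w}}) v - graph_disconnection_cost (V, E) v)
    \<le> graph_disconnection_cost (V, E - (\<lambda>w. {v, w}) ` W) v - graph_disconnection_cost (V, E) v"
proof (cases "connected_graph (V, E - (\<lambda>w. {v, w}) ` W)")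
  case False
  \<comment> \<open>The right-hand side is \<infinity> minus a finite cost.\<close>
  then show ?thesis
    using graph_disconnection_cost_connected[OF con V(2,1) E]
    by (simp add: graph_disconnection_cost_def)
next
  case conF: True
  define F where "F = (\<lambda>w. {v, w}) ` W"
  define b where "b = real (card (separating_pairs V v E))"
  define c where "c w = real (card (separating_pairs V v (E - {{v, w}})))" for w
  define a where "a = real (card (separating_pairs V v (E - F)))"
  define m where "m = real (card E)"
  define k where "k = real (card W)"
  define D where "D = (\<Sum>w\<in>W. c w - b)"
  \<comment> \<open>A single deletion keeps all edges that survive the joint one, so every cost
    below is finite.\<close>
  have conW: "connected_graph (V, E - {{v, w}})" if "w \<in> W" for w
    using that by (intro connected_graph_mono[OF conF]) auto
  have "card F = card W"
    unfolding F_def by (intro card_image) (auto simp: inj_on_def doubleton_eq_iff)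
  moreover have "F \<subseteq> E" "finite F"
    using W by (simp_all add: F_def)
  moreover from this have "card F \<le> card E"
    using E by (intro card_mono)
  ultimately have cardF: "real (card (E - F)) = m - k"
    by (simp add: m_def k_def card_Diff_subset of_nat_diff)
  have "card (E - F) > 0"
    using ne E by (simp add: F_def card_gt_0_iff)
  then have km: "k < m"
    using cardF by linarith
  have cardW: "real (card (E - {{v, w}})) = m - 1" if "w \<in> W" for w
  proof -
    have "{v, w} \<in> E"
      using that W by auto
    moreover from this E have "card E > 0"
      by (auto simp: card_gt_0_iff)
    ultimately show ?thesis
      using E by (simp add: m_def of_nat_diff)
  qed
  have finF: "finite (separating_pairs V v (E - F))"
    using separating_pairs_subset[OF conF V(2)] V E by (auto simp: F_def intro: finite_subset)
  have subF: "separating_pairs V v (E - {{v, w}}) \<subseteq> separating_pairs V v (E - F)" if "w \<in> W" for w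
    using that by (intro separating_pairs_antimono) (auto simp: F_def)
  have subW: "separating_pairs V v E \<subseteq> separating_pairs V v (E - {{v, w}})" for w
    by (intro separating_pairs_antimono) auto
  have Da: "D \<le> a - b"
    unfolding D_def a_def b_def c_def
  proof (rule sum_card_increments_le[OF finF W(1) subW subF])
    show "separating_pairs V v E \<subseteq> separating_pairs V v (E - F)"
      by (intro separating_pairs_antimono) auto
    show "separating_pairs V v (E - {{v, w}}) \<inter> separating_pairs V v (E - {{v, w'}})
        \<subseteq> separating_pairs V v E" if "w \<in> W" "w' \<in> W" "w \<noteq> w'" for w w'
      using that W(2) by (intro separating_pairs_Int) auto
  qed
  have D0: "0 \<le> D"
    unfolding D_def
  proof (rule sum_nonneg)
    fix w
    assume "w \<in> W"
    then show "0 \<le> c w - b"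
      using card_mono[OF finite_subset[OF subF finF] subW] by (simp add: b_def c_def)
  qed
  have "(\<Sum>w\<in>W. c w / (m - 1) - b / m) \<le> a / (m - k) - b / m"
  \<comment> \<open>\<open>mean_increment_le\<close> requires \<open>1 \<le> k\<close>; for empty
    \<open>W\<close> both sides are 0.\<close>
  proof (cases "W = {}")
    case True
    then show ?thesis
      by (simp add: a_def b_def k_def F_def)
  next
    case False
    then have "card W > 0"
      using W by (simp add: card_gt_0_iff)
    then have k1: "1 \<le> k"
      unfolding k_def by linarith
    \<comment> \<open>Splits the increase into the new pairs and the effect of the smaller
      denominator on the \<open>b\<close> old ones.\<close>
    have "c w / (m - 1) - b / m = (c w - b) / (m - 1) + b / (m * (m - 1))" for w
      using k1 km by (simp add: divide_simps) (simp add: algebra_simps)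
    then have "(\<Sum>w\<in>W. c w / (m - 1) - b / m) = D / (m - 1) + k * b / (m * (m - 1))"
      by (simp add: sum.distrib D_def k_def flip: sum_divide_distrib)
    then show ?thesis
      using mean_increment_le[of b D a k m] D0 Da k1 km by (simp add: b_def)
  qed
  then show ?thesis
    using graph_disconnection_cost_connected[OF con V(2,1) E]
      graph_disconnection_cost_connected[OF conF V(2,1)]
      graph_disconnection_cost_connected[OF conW V(2,1)] E cardW cardF
    by (simp add: F_def[symmetric] a_def b_def c_def m_def)
qed

section \<open>Bilateral link formation\<close>

text \<open>An edge needs both requests, so withdrawing one deletes it; if the edge is absent, the
  set difference changes nothing.\<close>

lemma bilateral_graph_remove_request:
  assumes "v \<noteq> w"
  shows "bilateral_graph n (remove_request S (v, w)) =
    (players n, snd (bilateral_graph n S) - {{v, w}})"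
proof -
  have "remove_request S (v, w) x y = 1 \<and> remove_request S (v, w) y x = 1 \<longleftrightarrow>
      S x y = 1 \<and> S y x = 1 \<and> {x, y} \<noteq> {v, w}" for x y
    using assms by (auto simp: remove_request_def doubleton_eq_iff)
  then show ?thesis
    unfolding bilateral_graph_def by (simp only: snd_conv prod.inject) blast
qed

lemma bilateral_graph_remove_requests:
  assumes "v \<notin> set ws"
  shows "bilateral_graph n (foldl (\<lambda>T w. remove_request T (v, w)) S ws) =
    (players n, snd (bilateral_graph n S) - (\<lambda>w. {v, w}) ` set ws)"
  using assms
proof (induction ws arbitrary: S)
  case Nil
  show ?case
    by (simp add: bilateral_graph_def)
next
  case (Cons w ws)
  then show ?case
    by (auto simp: bilateral_graph_remove_request)
qed

lemma connected_graph_edges_nonempty: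
  assumes "connected_graph (V, E)" "u \<in> V" "v \<in> V" "u \<noteq> v"
  shows "E \<noteq> {}"
proof -
  obtain p where p: "walk_betw (V, E) u p v"
    using assms by (auto simp: connected_graph_def)
  then obtain x y zs where "p = x # y # zs"
    using assms(4) by (cases p rule: remdups_adj.cases) (auto simp: walk_betw_def)
  then show ?thesis
    using p by (auto simp: walk_betw_def)
qed

theorem lemma10p4:
  fixes n :: nat and S :: profile and v :: nat and ws :: "nat list"
  assumes "n \<ge> 3"
    and "strategy_profile n S"
    and "connected_graph (bilateral_graph n S)"
    and "v \<in> players n"
    and "ws \<noteq> []" and "distinct ws" and "set ws \<subseteq> players n - {v}"
  shows "disconnection_cost n (foldl (\<lambda>T w. remove_request T (v, w)) S ws) v
           - disconnection_cost n S v
         \<ge> (\<Sum>w\<leftarrow>ws. disconnection_cost n (remove_request S (v, w)) v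
                      - disconnection_cost n S v)"
proof -
  define V where "V = players n"
  define E where "E = snd (bilateral_graph n S)"
  \<comment> \<open>Only requests in \<open>W\<close> are reciprocated; withdrawing any other leaves
    the graph unchanged.\<close>
  define W where "W = {w \<in> set ws. {v, w} \<in> E}"
  have G: "bilateral_graph n S = (V, E)"
    by (simp add: E_def V_def bilateral_graph_def)
  have con: "connected_graph (V, E)"
    using assms(3) G by simp
  have V: "finite V" "v \<in> V"
    using assms(4) by (simp_all add: V_def players_def)
  have "E \<subseteq> Pow V"
    by (auto simp: E_def V_def bilateral_graph_def)
  then have E: "finite E"
    using V finite_subset by blast
  have vws: "v \<notin> set ws"
    using assms(7) by auto
  have EW: "E - (\<lambda>w. {v, w}) ` set ws = E - (\<lambda>w. {v, w}) ` W"
    by (auto simp: W_def)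
  let ?I = "\<lambda>E. graph_disconnection_cost (V, E) v"
  have fin: "\<bar>?I E\<bar> \<noteq> \<infinity>"
    using graph_disconnection_cost_connected[OF con V(2,1) E] by simp
  have "(\<Sum>w\<leftarrow>ws. disconnection_cost n (remove_request S (v, w)) v - disconnection_cost n S v) =
      (\<Sum>w\<in>set ws. disconnection_cost n (remove_request S (v, w)) v - disconnection_cost n S v)"
    using assms(6) by (rule sum_list_distinct_conv_sum_set)
  also have "\<dots> = (\<Sum>w\<in>set ws. ?I (E - {{v, w}}) - ?I E)"
  proof (intro sum.cong refl)
    fix w
    assume "w \<in> set ws"
    then have "v \<noteq> w"
      using vws by auto
    then show "disconnection_cost n (remove_request S (v, w)) v - disconnection_cost n S v =
        ?I (E - {{v, w}}) - ?I E"
      by (simp add: disconnection_cost_def bilateral_graph_remove_request G V_def)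
  qed
  also have "\<dots> = (\<Sum>w\<in>W. ?I (E - {{v, w}}) - ?I E)"
    \<comment> \<open>Outside \<open>W\<close> the summand is \<open>?I E - ?I E\<close>, which is 0
      because \<open>?I E\<close> is finite.\<close>
    using fin by (intro sum.mono_neutral_right) (auto simp: W_def)
  also have "\<dots> \<le> ?I (E - (\<lambda>w. {v, w}) ` W) - ?I E"
  proof (cases "E - (\<lambda>w. {v, w}) ` W = {}")
    case True
    \<comment> \<open>A second player exists as \<open>n \<ge> 3\<close>, so losing all edges
      disconnects the graph and the cost is \<infinity>, not a mean over zero edges.\<close>
    obtain u where "u \<in> V" "u \<noteq> v"
    proof (cases "v = 1")
      case True
      then show thesis
        using that[of 2] assms(1) by (simp add: V_def players_def)
    next
      case False
      then show thesis
        using that[of 1] assms(1) by (simp add: V_def players_def)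
    qed
    then have "\<not> connected_graph (V, E - (\<lambda>w. {v, w}) ` W)"
      using True connected_graph_edges_nonempty V(2) by metis
    then have "?I (E - (\<lambda>w. {v, w}) ` W) = \<infinity>"
      by (simp add: graph_disconnection_cost_def)
    then show ?thesis
      using fin by simp
  next
    case False
    then show ?thesis
      using V E vws con by (intro graph_disconnection_cost_convex) (auto simp: W_def)
  qed
  also have "\<dots> = disconnection_cost n (foldl (\<lambda>T w. remove_request T (v, w)) S ws) v
      - disconnection_cost n S v"
    using bilateral_graph_remove_requests[OF vws, of n S] EW G
    by (simp add: disconnection_cost_def V_def)
  finally show ?thesis .
qed

end
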